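(* Let $\beta>0$, let $f_1,f_2,\dots$ be distributed according to $\nu_\beta$, and suppose that $x=\exp(-f_+)$. Let $p,q$ be multi-indices. If $\deg(p)=\deg(q)$, then $$E(x^p(x^q)^* )=\sum \frac{1}{\prod_{n,r} (J_{n,r}!)\prod_{m,s}(K_{m,s}!)}\; \frac{\left(\sum_{n,r} J_{n,r}\right)!}{\prod_u u^{(\sum_{n,r} J_{n,r})(u)}}\;\beta^{-|\sum_{n,r} J_{n,r}|},$$ where the sum is over all families of multi-indices $J_{n,r},K_{m,s}$, indexed by $n,m>0$, $1\le r\le p(n)$, $1\le s\le q(m)$, which satisfy $\deg(J_{n,r})=n$, $\deg(K_{m,s})=m$ and $\sum_{n,r} J_{n,r}=\sum_{m,s} K_{m,s}$ (equality of two multi-indices). If $\deg(p)\ne \deg(q)$, then the expectation vanishes.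
   Context: A multi-index is a sequence $p=(p(1),p(2),\dots)$ of non-negative integers with only finitely many nonzero entries; $p!=\prod_j p(j)!$, $|p|=\sum_j p(j)$, $\deg(p)=\sum_j j\,p(j)$. The measure $$d\nu_{\beta}=\prod_{n=1}^{\infty}\frac{n\beta}{\pi}e^{-n\beta|f_n|^2}d\lambda(f_n)$$ ($\lambda$ Lebesgue measure on $\mathbb C$) makes $f_1,f_2,\dots$ independent centered complex Gaussians. $f_+(z)=\sum_{n\ge1}f_nz^n$, and $x_n$ is the coefficient of $z^n$ in $x=\exp(-f_+)=1+\sum_{n\ge1}x_nz^n$; $x^p=\prod_{n\ge1}x_n^{p(n)}$, and $(\cdot)^*$ is complex conjugation. $E$ is expectation with respect to $\nu_\beta$. *)

theory Defs
  imports
    "HOL-Probability.Probability"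
    "HOL-Computational_Algebra.Formal_Power_Series"
    "HOL-Library.Poly_Mapping"
begin

text \<open>
  Multi-indices are finitely supported maps on the positive integers. They are represented by
  finitely supported maps on \<open>nat\<close> that vanish at \<open>0\<close>; without this condition
  there would be infinitely many multi-indices of a given degree.
\<close>

type_synonym multi_index = "nat \<Rightarrow>\<^sub>0 nat"

definition is_multi_index :: "multi_index \<Rightarrow> bool" where
  "is_multi_index p \<longleftrightarrow> Poly_Mapping.lookup p 0 = 0"

definition mi_fact :: "multi_index \<Rightarrow> nat" where
  "mi_fact p = (\<Prod>j\<in>Poly_Mapping.keys p. fact (Poly_Mapping.lookup p j))"

definition mi_size :: "multi_index \<Rightarrow> nat" where
  "mi_size p = (\<Sum>j\<in>Poly_Mapping.keys p. Poly_Mapping.lookup p j)"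

definition mi_deg :: "multi_index \<Rightarrow> nat" where
  "mi_deg p = (\<Sum>j\<in>Poly_Mapping.keys p. j * Poly_Mapping.lookup p j)"

definition mi_power :: "(nat \<Rightarrow> 'a::comm_monoid_mult) \<Rightarrow> multi_index \<Rightarrow> 'a" where
  "mi_power a p = (\<Prod>j\<in>Poly_Mapping.keys p. a j ^ Poly_Mapping.lookup p j)"

definition nu :: "real \<Rightarrow> (nat \<Rightarrow> complex) measure" where
  "nu \<beta> = (\<Pi>\<^sub>M n\<in>{1..}. density lborel
     (\<lambda>z::complex. ennreal (real n * \<beta> / pi * exp (- (real n * \<beta> * (cmod z)\<^sup>2)))))"

definition f_plus :: "(nat \<Rightarrow> complex) \<Rightarrow> complex fps" where
  "f_plus f = Abs_fps (\<lambda>n. if n = 0 then 0 else f n)"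

text \<open>
  The exponential is taken in the ring of formal power series, so that the coefficients are
  defined for every sequence \<open>f\<close>. Whenever \<open>f_plus f\<close> has positive radius of convergence
  (which is almost surely the case) they are the Taylor coefficients at \<open>0\<close> of the
  holomorphic function \<open>exp (- f\<^sub>+(z))\<close>.
\<close>

definition x_series :: "(nat \<Rightarrow> complex) \<Rightarrow> complex fps" where
  "x_series f = fps_compose (fps_exp 1) (- f_plus f)"

definition x_coeff :: "(nat \<Rightarrow> complex) \<Rightarrow> nat \<Rightarrow> complex" where
  "x_coeff f n = fps_nth (x_series f) n"

definition family_index :: "multi_index \<Rightarrow> (nat \<times> nat) set" where
  "family_index p = {(n, r). 0 < n \<and> 1 \<le> r \<and> r \<le> Poly_Mapping.lookup p n}"

text \<open>
  Families \<open>J\<^sub>n\<^sub>,\<^sub>r\<close> of multi-indices with \<open>deg J\<^sub>n\<^sub>,\<^sub>r = n\<close>. The extensional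
  function space makes each family occur exactly once.
\<close>

definition families :: "multi_index \<Rightarrow> (nat \<times> nat \<Rightarrow> multi_index) set" where
  "families p =
     (\<Pi>\<^sub>E (n, r)\<in>family_index p. {j. is_multi_index j \<and> mi_deg j = n})"

definition family_sum :: "multi_index \<Rightarrow> (nat \<times> nat \<Rightarrow> multi_index) \<Rightarrow> multi_index" where
  "family_sum p J = (\<Sum>i\<in>family_index p. J i)"

definition family_pairs ::
  "multi_index \<Rightarrow> multi_index \<Rightarrow>
     ((nat \<times> nat \<Rightarrow> multi_index) \<times> (nat \<times> nat \<Rightarrow> multi_index)) set" where
  "family_pairs p q =
     {(J, K). J \<in> families p \<and> K \<in> families q \<and> family_sum p J = family_sum q K}"

end

theory Submission
  imports Defs
begin

text \<open>
  The coefficient \<open>x\<^sub>n\<close> equals \<open>\<Sum> (- f)\<^sup>J / J!\<close> over the multi-indices \<open>J\<close> of degree \<open>n\<close>, hence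
  \<open>x\<^sup>p (x\<^sup>q)\<^sup>*\<close> is a finite sum, over pairs of families \<open>J\<close>, \<open>K\<close>, of monomials in the \<open>f\<^sub>k\<close> and
  their conjugates. By independence the expectation of a monomial factors, and
  \<open>E (f\<^sub>k\<^sup>a (f\<^sub>k\<^sup>*)\<^sup>b)\<close> is \<open>a! / (k\<beta>)\<^sup>a\<close> if \<open>a = b\<close> and \<open>0\<close> otherwise, so that only the pairs with
  \<open>\<Sum>J = \<Sum>K\<close> contribute. For these the signs cancel and the degrees of \<open>p\<close> and \<open>q\<close> agree.
\<close>

section \<open>The coefficients of the exponential\<close>

abbreviation lookup where "lookup \<equiv> Poly_Mapping.lookup"
abbreviation keys where "keys \<equiv> Poly_Mapping.keys"

definition multi_indices :: "nat \<Rightarrow> multi_index set" where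
  "multi_indices n = {j. is_multi_index j \<and> mi_deg j = n}"

text \<open>The term belonging to \<open>j\<close> when the product of the series
  \<open>exp (- f k z^k)\<close> over all \<open>k\<close> is multiplied out.\<close>

definition exp_term :: "(nat \<Rightarrow> complex) \<Rightarrow> multi_index \<Rightarrow> complex" where
  "exp_term f j = (\<Prod>k\<in>keys j. (- f k) ^ lookup j k / fact (lookup j k))"

section \<open>Arithmetic of multi-indices\<close>

text \<open>Off the support the exponent is 0 and the factor is 1. This and the analogues below
  allow several multi-indices to be treated over one common finite set.\<close>

lemma mi_fact_superset:
  assumes "finite S" "keys j \<subseteq> S"
  shows "mi_fact j = (\<Prod>k\<in>S. fact (lookup j k))"
  unfolding mi_fact_def using assms
  by (intro prod.mono_neutral_left) (auto simp: in_keys_iff)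

lemma mi_size_superset:
  assumes "finite S" "keys j \<subseteq> S"
  shows "mi_size j = (\<Sum>k\<in>S. lookup j k)"
  unfolding mi_size_def using assms
  by (intro sum.mono_neutral_left) (auto simp: in_keys_iff)

lemma mi_deg_superset:
  assumes "finite S" "keys j \<subseteq> S"
  shows "mi_deg j = (\<Sum>k\<in>S. k * lookup j k)"
  unfolding mi_deg_def using assms
  by (intro sum.mono_neutral_left) (auto simp: in_keys_iff)

lemma mi_power_superset:
  assumes "finite S" "keys j \<subseteq> S"
  shows "mi_power a j = (\<Prod>k\<in>S. a k ^ lookup j k)"
  unfolding mi_power_def using assms
  by (intro prod.mono_neutral_left) (auto simp: in_keys_iff)

lemma exp_term_superset:
  assumes "finite S" "keys j \<subseteq> S"
  shows "exp_term f j = (\<Prod>k\<in>S. (- f k) ^ lookup j k / fact (lookup j k))"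
  unfolding exp_term_def using assms
  by (intro prod.mono_neutral_left) (auto simp: in_keys_iff)

lemma mi_size_add: "mi_size (a + b) = mi_size a + mi_size b"
  unfolding mi_size_def by (rule setsum_keys_plus_distrib) auto

lemma mi_deg_add: "mi_deg (a + b) = mi_deg a + mi_deg b"
  unfolding mi_deg_def by (rule setsum_keys_plus_distrib) (auto simp: algebra_simps)

lemma mi_power_add: "mi_power f (a + b) = mi_power f a * mi_power f b"
proof -
  have "mi_power f c = (\<Prod>k\<in>keys a \<union> keys b. f k ^ lookup c k)" if "c \<in> {a, b, a + b}" for c
    using that keys_add[of a b] by (intro mi_power_superset) auto
  then show ?thesis
    by (simp add: lookup_add power_add prod.distrib)
qed

lemma is_multi_index_add: "is_multi_index (a + b) \<longleftrightarrow> is_multi_index a \<and> is_multi_index b"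
  by (simp add: is_multi_index_def lookup_add)

lemma mi_zero: "is_multi_index 0" "mi_size 0 = 0" "mi_deg 0 = 0" "mi_power f 0 = 1"
  by (simp_all add: is_multi_index_def mi_size_def mi_deg_def mi_power_def)

lemma
  fixes J :: "'a \<Rightarrow> multi_index"
  shows is_multi_index_sum: "(\<And>i. i \<in> I \<Longrightarrow> is_multi_index (J i)) \<Longrightarrow> is_multi_index (\<Sum>i\<in>I. J i)"
    and mi_size_sum: "mi_size (\<Sum>i\<in>I. J i) = (\<Sum>i\<in>I. mi_size (J i))"
    and mi_deg_sum: "mi_deg (\<Sum>i\<in>I. J i) = (\<Sum>i\<in>I. mi_deg (J i))"
    and mi_power_sum: "mi_power f (\<Sum>i\<in>I. J i) = (\<Prod>i\<in>I. mi_power f (J i))"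
  by (induction I rule: infinite_finite_induct)
    (simp_all add: mi_zero mi_size_add mi_deg_add mi_power_add is_multi_index_add)

lemma exp_term_eq:
  "exp_term f j = (-1) ^ mi_size j * mi_power f j / of_nat (mi_fact j)"
proof -
  have "(- f k) ^ n = (-1) ^ n * f k ^ n" for k n
    by (simp flip: power_mult_distrib)
  then show ?thesis
    by (simp add: exp_term_def mi_size_def mi_power_def mi_fact_def prod_dividef prod.distrib
        power_sum)
qed

text \<open>Only the factor at \<open>k\<close> changes: it gains \<open>- f k\<close>, and the new
  factor of the factorial cancels against the prefactor.\<close>

lemma exp_term_add_single:
  "of_nat (Suc (lookup j k)) * exp_term f (j + Poly_Mapping.single k 1) = - f k * exp_term f j"
proof -
  \<comment> \<open>The support of \<open>j\<close> need not contain \<open>k\<close>, so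
    \<open>k\<close> is inserted to make its factor available for splitting off.\<close>
  define S where "S = insert k (keys j)"
  have S: "finite S" "k \<in> S" "keys j \<subseteq> S" "keys (j + Poly_Mapping.single k 1) \<subseteq> S"
    using keys_add[of j "Poly_Mapping.single k 1"] by (auto simp: S_def)
  let ?R = "\<Prod>l\<in>S - {k}. (- f l) ^ lookup j l / fact (lookup j l)"
  have "exp_term f (j + Poly_Mapping.single k 1) =
      (- f k) ^ Suc (lookup j k) / fact (Suc (lookup j k)) *
      (\<Prod>l\<in>S - {k}. (- f l) ^ lookup (j + Poly_Mapping.single k 1) l
         / fact (lookup (j + Poly_Mapping.single k 1) l))"
    using S by (simp add: exp_term_superset[of S] prod.remove[of S k] lookup_add)
  also have "(\<Prod>l\<in>S - {k}. (- f l) ^ lookup (j + Poly_Mapping.single k 1) l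
         / fact (lookup (j + Poly_Mapping.single k 1) l)) = ?R"
    by (intro prod.cong) (auto simp: lookup_add lookup_single)
  finally have 1: "exp_term f (j + Poly_Mapping.single k 1) =
      (- f k) ^ Suc (lookup j k) / fact (Suc (lookup j k)) * ?R" .
  have 2: "exp_term f j = (- f k) ^ lookup j k / fact (lookup j k) * ?R"
    using S by (simp add: exp_term_superset[of S] prod.remove[of S k])
  have "of_nat (Suc m) * (x ^ Suc m / fact (Suc m) * r) = x * (x ^ m / fact m * r)"
    for m and x r :: complex
    unfolding fact_Suc by (simp add: divide_simps del: of_nat_Suc)
  then show ?thesis unfolding 1 2 .
qed

section \<open>Multi-indices of a given degree\<close>

text \<open>On the support both factors of \<open>k * lookup j k\<close> are at least 1, and this
  product is one summand of the degree, so each factor is at most \<open>n\<close>.\<close>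

lemma multi_indices_bounds:
  assumes "j \<in> multi_indices n"
  shows "keys j \<subseteq> {1..n}" "lookup j k \<le> n"
proof -
  have 0: "lookup j 0 = 0" and deg: "(\<Sum>k\<in>keys j. k * lookup j k) = n"
    using assms by (auto simp: multi_indices_def is_multi_index_def mi_deg_def)
  have le: "1 \<le> l \<and> l \<le> n \<and> lookup j l \<le> n" if "l \<in> keys j" for l
  proof -
    have "l * lookup j l \<le> n"
      using member_le_sum[of l "keys j" "\<lambda>k. k * lookup j k"] deg that by auto
    moreover have "l \<noteq> 0" "lookup j l \<noteq> 0"
      using that 0 by (auto simp: in_keys_iff intro: ccontr)
    then have "l \<le> l * lookup j l" "lookup j l \<le> l * lookup j l" by auto
    ultimately show ?thesis
      using \<open>l \<noteq> 0\<close> by linarith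
  qed
  show "keys j \<subseteq> {1..n}"
    using le by auto
  show "lookup j k \<le> n"
    using le[of k] by (cases "k \<in> keys j") (auto simp: in_keys_iff)
qed

lemma finite_multi_indices: "finite (multi_indices n)"
proof (rule finite_imageD)
  have "lookup ` multi_indices n \<subseteq>
      {h. \<forall>x. (x \<in> {..n} \<longrightarrow> h x \<in> {..n}) \<and> (x \<notin> {..n} \<longrightarrow> h x = 0)}"
    using multi_indices_bounds by (fastforce simp: in_keys_iff subset_iff)
  then show "finite (lookup ` multi_indices n)"
    by (rule finite_subset) (intro finite_set_of_finite_funs finite_atMost)
  show "inj_on lookup (multi_indices n)"
    by (simp add: inj_on_def lookup_inject)
qed

lemma multi_indices_0: "multi_indices 0 = {0}"
proof -
  have "j = 0" if "j \<in> multi_indices 0" for j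
    using multi_indices_bounds(1)[OF that] by simp
  then show ?thesis
    by (auto simp: multi_indices_def mi_zero)
qed

text \<open>Lowering the exponent at \<open>k\<close> by one is a bijection from the multi-indices
  of degree \<open>n\<close> with \<open>k\<close> in their support onto those of degree
  \<open>n - k\<close>; the weight \<open>lookup j k\<close> removes all others.\<close>

lemma sum_lookup_exp_term:
  assumes "1 \<le> k" "k \<le> n"
  shows "(\<Sum>j\<in>multi_indices n. of_nat (lookup j k) * exp_term f j) =
    - f k * (\<Sum>j\<in>multi_indices (n - k). exp_term f j)"
proof -
  let ?s = "Poly_Mapping.single k (1::nat)"
  have s: "is_multi_index ?s" "mi_deg ?s = k"
    using assms by (auto simp: is_multi_index_def mi_deg_def lookup_single)
  have "(\<Sum>j\<in>multi_indices n. of_nat (lookup j k) * exp_term f j) =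
      (\<Sum>j\<in>{j\<in>multi_indices n. lookup j k \<noteq> 0}. of_nat (lookup j k) * exp_term f j)"
    by (intro sum.mono_neutral_right finite_multi_indices) auto
  also have "\<dots> = (\<Sum>j\<in>multi_indices (n - k). - f k * exp_term f j)"
  proof -
    \<comment> \<open>Subtraction is truncated, so lowering and then raising the exponent is the
      identity only where it is nonzero.\<close>
    have cancel: "j - ?s + ?s = j" if "lookup j k \<noteq> 0" for j
      using that
      by (intro poly_mapping_eqI) (auto simp: lookup_add lookup_minus lookup_single when_def)
    have deg: "j + ?s \<in> multi_indices n \<longleftrightarrow> j \<in> multi_indices (n - k)" for j
      using s assms by (auto simp: multi_indices_def is_multi_index_add mi_deg_add)
    have expand: "of_nat (lookup j k) * exp_term f j = - f k * exp_term f (j - ?s)"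
      if "lookup j k \<noteq> 0" for j
      using exp_term_add_single[of "j - ?s" k f] cancel[OF that] that
      by (simp add: lookup_minus del: of_nat_Suc)
    show ?thesis
      using cancel deg expand
      by (intro sum.reindex_bij_witness[of _ "\<lambda>j. j + ?s" "\<lambda>j. j - ?s"])
        (auto simp: lookup_add, metis+)
  qed
  finally show ?thesis by (simp add: sum_distrib_left)
qed

text \<open>Both sides satisfy the recurrence \<open>n x\<^sub>n = - (\<Sum>k=1..n. k f\<^sub>k x\<^sub>n\<^sub>-\<^sub>k)\<close>, which for the
  coefficients of the exponential expresses \<open>x' = - f\<^sub>+' x\<close>.\<close>

lemma x_coeff_eq: "x_coeff f n = (\<Sum>j\<in>multi_indices n. exp_term f j)"
proof (induction n rule: less_induct)
  case (less n)
  show ?case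
  proof (cases n)
    case 0
    then show ?thesis
      by (simp add: multi_indices_0 x_coeff_def x_series_def exp_term_def)
  next
    case (Suc m)
    have "fps_deriv (x_series f) = x_series f * fps_deriv (- f_plus f)"
      unfolding x_series_def
      by (subst fps_compose_deriv) (simp_all add: f_plus_def)
    then have "fps_nth (fps_deriv (x_series f)) m = fps_nth (fps_deriv (- f_plus f) * x_series f) m"
      by (simp add: mult.commute)
    then have "of_nat n * x_coeff f n =
        (\<Sum>i=0..m. - (of_nat (Suc i) * f (Suc i)) * x_coeff f (m - i))"
      by (simp add: fps_mult_nth x_coeff_def f_plus_def Suc sum_negf del: of_nat_Suc)
    also have "\<dots> = (\<Sum>k=1..n. of_nat k * (- f k * x_coeff f (n - k)))"
      unfolding Suc by (rule sum.reindex_bij_witness[of _ "\<lambda>k. k - 1" Suc]) auto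
    \<comment> \<open>Since \<open>k \<ge> 1\<close>, the induction hypothesis covers
      \<open>n - k\<close>; the shift of multi-indices then brings everything back to degree
      \<open>n\<close>.\<close>
    also have "\<dots> = (\<Sum>k=1..n. of_nat k * (\<Sum>j\<in>multi_indices n. of_nat (lookup j k) * exp_term f j))"
      by (intro sum.cong refl) (simp add: less sum_lookup_exp_term)
    also have "\<dots> = (\<Sum>j\<in>multi_indices n. \<Sum>k=1..n. of_nat k * (of_nat (lookup j k) * exp_term f j))"
      unfolding sum_distrib_left by (rule sum.swap)
    also have "\<dots> = (\<Sum>j\<in>multi_indices n. of_nat n * exp_term f j)"
    proof (rule sum.cong[OF refl])
      fix j assume j: "j \<in> multi_indices n"
      \<comment> \<open>The weights \<open>k * lookup j k\<close> add up to the degree of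
        \<open>j\<close>, so the inner sum collapses.\<close>
      then have "n = (\<Sum>k=1..n. k * lookup j k)"
        using mi_deg_superset[of "{1..n}" j] multi_indices_bounds(1)[OF j]
        by (simp add: multi_indices_def)
      then have "(of_nat n :: complex) = (\<Sum>k=1..n. of_nat k * of_nat (lookup j k))"
        by (metis (mono_tags, lifting) of_nat_mult of_nat_sum sum.cong)
      then show "(\<Sum>k=1..n. of_nat k * (of_nat (lookup j k) * exp_term f j)) = of_nat n * exp_term f j"
        by (simp add: sum_distrib_right mult.assoc)
    qed
    finally show ?thesis
      using Suc by (simp flip: sum_distrib_left del: of_nat_Suc)
  qed
qed

section \<open>Families of multi-indices and the expansion of
  \<open>mi_power (x_coeff f) p\<close>\<close>

lemma family_index_Sigma:
  assumes "is_multi_index p"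
  shows "family_index p = Sigma (keys p) (\<lambda>n. {1..lookup p n})"
  using assms by (auto simp: family_index_def is_multi_index_def in_keys_iff intro!: gr0I)

lemma finite_family_index: "is_multi_index p \<Longrightarrow> finite (family_index p)"
  by (simp add: family_index_Sigma)

lemma families_eq: "families p = (\<Pi>\<^sub>E i\<in>family_index p. multi_indices (fst i))"
  unfolding families_def multi_indices_def by (intro PiE_cong) auto

lemma finite_families: "is_multi_index p \<Longrightarrow> finite (families p)"
  unfolding families_eq by (intro finite_PiE finite_family_index finite_multi_indices)

lemma families_memD:
  assumes "J \<in> families p"
  shows "i \<in> family_index p \<Longrightarrow> J i \<in> multi_indices (fst i)"
  using assms by (auto simp: families_eq)

lemma is_multi_index_family_sum:
  assumes "J \<in> families p"
  shows "is_multi_index (family_sum p J)"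
  unfolding family_sum_def using families_memD[OF assms]
  by (intro is_multi_index_sum) (auto simp: multi_indices_def)

text \<open>The member at \<open>(n, r)\<close> contributes degree \<open>n\<close>, and each
  \<open>n\<close> occurs \<open>lookup p n\<close> times. Equal family sums therefore force equal
  degrees of \<open>p\<close> and \<open>q\<close>.\<close>

lemma mi_deg_family_sum:
  assumes "is_multi_index p" "J \<in> families p"
  shows "mi_deg (family_sum p J) = mi_deg p"
proof -
  have "mi_deg (family_sum p J) = (\<Sum>i\<in>family_index p. fst i)"
    unfolding family_sum_def mi_deg_sum using families_memD[OF assms(2)]
    by (intro sum.cong) (auto simp: multi_indices_def)
  also have "\<dots> = (\<Sum>n\<in>keys p. \<Sum>r=1..lookup p n. n)"
    unfolding family_index_Sigma[OF assms(1)] by (subst sum.Sigma) (auto simp: case_prod_unfold)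
  finally show ?thesis
    by (simp add: mi_deg_def mult.commute)
qed

definition family_coeff :: "multi_index \<Rightarrow> (nat \<times> nat \<Rightarrow> multi_index) \<Rightarrow> complex" where
  "family_coeff p J =
    (-1) ^ mi_size (family_sum p J) / of_nat (\<Prod>i\<in>family_index p. mi_fact (J i))"

text \<open>Multiplying out a product of sums picks one multi-index for each factor, which is a
  family; the product of the chosen monomials is the monomial of the family sum.\<close>

lemma mi_power_x_coeff:
  assumes "is_multi_index p"
  shows "mi_power (x_coeff f) p =
    (\<Sum>J\<in>families p. family_coeff p J * mi_power f (family_sum p J))"
proof -
  have "mi_power (x_coeff f) p = (\<Prod>n\<in>keys p. \<Prod>r=1..lookup p n. x_coeff f n)"
    by (simp add: mi_power_def)
  also have "\<dots> = (\<Prod>i\<in>family_index p. x_coeff f (fst i))"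
    unfolding family_index_Sigma[OF assms(1)] by (subst prod.Sigma) (auto simp: case_prod_unfold)
  also have "\<dots> = (\<Sum>J\<in>families p. \<Prod>i\<in>family_index p. exp_term f (J i))"
    unfolding x_coeff_eq families_eq
    by (intro prod_sum_PiE finite_family_index finite_multi_indices assms)
  also have "\<dots> = (\<Sum>J\<in>families p. family_coeff p J * mi_power f (family_sum p J))"
    by (intro sum.cong refl)
      (simp add: exp_term_eq family_coeff_def family_sum_def mi_size_sum mi_power_sum power_sum
        prod.distrib prod_dividef)
  finally show ?thesis .
qed

section \<open>Moments of complex Gaussians\<close>

text \<open>Lebesgue measure is determined by its values on boxes, and a complex box is a product of
  two real intervals.\<close>

lemma lborel_complex: "(lborel :: complex measure) = distr (lborel \<Otimes>\<^sub>M lborel) borel (\<lambda>(x, y). Complex x y)"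
proof (rule lborel_eqI)
  have [measurable]: "(\<lambda>(x, y). Complex x y) \<in> borel_measurable (lborel \<Otimes>\<^sub>M lborel)"
    unfolding Complex_eq by measurable
  fix l u :: complex
  assume le: "\<And>b. b \<in> Basis \<Longrightarrow> l \<bullet> b \<le> u \<bullet> b"
  have "Re l \<le> Re u" "Im l \<le> Im u"
    using le[of 1] le[of \<i>] by (auto simp: Basis_complex_def)
  moreover have "(\<lambda>(x, y). Complex x y) -` box l u \<inter> space (lborel \<Otimes>\<^sub>M lborel) =
      box (Re l) (Re u) \<times> box (Im l) (Im u)"
    by (auto simp: box_def Basis_complex_def space_pair_measure)
  ultimately show "emeasure (distr (lborel \<Otimes>\<^sub>M lborel) borel (\<lambda>(x, y). Complex x y)) (box l u) =
      (\<Prod>b\<in>Basis. (u - l) \<bullet> b)"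
    by (simp add: emeasure_distr lborel.emeasure_pair_measure_Times Basis_complex_def ennreal_mult)
qed simp

text \<open>For \<open>c > 0\<close> this is the law of a centered complex Gaussian with
  \<open>E |z|^2 = 1/c\<close>: real and imaginary part are independent normals of variance
  \<open>1/(2c)\<close>.\<close>

definition complex_gaussian :: "real \<Rightarrow> complex measure" where
  "complex_gaussian c = density lborel (\<lambda>z. ennreal (c / pi * exp (- (c * (cmod z)\<^sup>2))))"

lemma space_complex_gaussian [simp]: "space (complex_gaussian c) = UNIV"
  by (simp add: complex_gaussian_def)

definition normal_moment :: "real \<Rightarrow> nat \<Rightarrow> real" where
  "normal_moment \<sigma> k = (\<integral>x. normal_density 0 \<sigma> x * x ^ k \<partial>lborel)"

lemma normal_moment_0: "\<sigma> > 0 \<Longrightarrow> normal_moment \<sigma> 0 = 1"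
  using integral_normal_moment_even[of \<sigma> 0 0] by (simp add: normal_moment_def)

text \<open>This is integration by parts in one dimension, read off from the closed formulas. For
  even \<open>k\<close> both sides vanish; at \<open>k = 0\<close> the factor \<open>k\<close> makes
  the truncated \<open>k - 1\<close> harmless.\<close>

lemma normal_moment_Suc:
  assumes "\<sigma> > 0"
  shows "normal_moment \<sigma> (Suc k) = \<sigma>\<^sup>2 * k * normal_moment \<sigma> (k - 1)"
proof (cases "even k")
  case True
  then obtain m where "k = 2 * m" by blast
  then show ?thesis
    using integral_normal_moment_odd[OF assms, of 0 m]
      integral_normal_moment_odd[OF assms, of 0 "m - 1"]
    by (cases m) (simp_all add: normal_moment_def)
next
  case False
  then obtain m where m: "k = 2 * m + 1" by (blast elim: oddE)
  have "normal_moment \<sigma> (2 * l) = fact (2 * l) / ((2 / \<sigma>\<^sup>2) ^ l * fact l)" for l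
    using integral_normal_moment_even[OF assms, of 0 l] by (simp add: normal_moment_def)
  note moment = this
  have "normal_moment \<sigma> (Suc k) = normal_moment \<sigma> (2 * Suc m)" by (simp add: m)
  \<comment> \<open>With \<open>k = 2 * m + 1\<close>, the factorial of \<open>2 * Suc m\<close> is
    \<open>(2 * Suc m) * k * fact (2 * m)\<close>.\<close>
  also have "\<dots> = (2 * real (Suc m)) * (real k * fact (2 * m)) /
      (2 / \<sigma>\<^sup>2 * (2 / \<sigma>\<^sup>2) ^ m * (real (Suc m) * fact m))"
    unfolding moment power_Suc by (simp add: m algebra_simps)
  also have "\<dots> = \<sigma>\<^sup>2 * real k * normal_moment \<sigma> (2 * m)"
  proof -
    have "(2 * x) * (y * f) / (2 / s * p * (x * g)) = s * y * (f / (p * g))"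
      if "x \<noteq> 0" "s \<noteq> 0" for x y f s p g :: real
      using that by (simp add: divide_simps)
    from this[of "real (Suc m)" "\<sigma>\<^sup>2"] show ?thesis
      using assms unfolding moment by (simp del: of_nat_Suc)
  qed
  finally show ?thesis by (simp add: m)
qed

text \<open>For this parameter the planar density is the product of two normal densities of standard
  deviation \<sigma>, because the squared modulus is the sum of the squared coordinates.\<close>

lemma complex_gaussian_integral:
  fixes h :: "complex \<Rightarrow> complex"
  assumes "\<sigma> > 0" and [measurable]: "h \<in> borel_measurable borel"
  defines "F \<equiv> \<lambda>(x, y). complex_of_real (normal_density 0 \<sigma> x * normal_density 0 \<sigma> y) * h (Complex x y)"
  shows "integrable (complex_gaussian (1 / (2 * \<sigma>\<^sup>2))) h \<longleftrightarrow> integrable (lborel \<Otimes>\<^sub>M lborel) F"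
    and "(\<integral>z. h z \<partial>complex_gaussian (1 / (2 * \<sigma>\<^sup>2))) = (\<integral>p. F p \<partial>(lborel \<Otimes>\<^sub>M lborel))"
proof -
  have [measurable]: "(\<lambda>(x, y). Complex x y) \<in> borel_measurable (lborel \<Otimes>\<^sub>M lborel)"
    unfolding Complex_eq by measurable
  let ?c = "1 / (2 * \<sigma>\<^sup>2)"
  let ?G = "\<lambda>z. (?c / pi * exp (- (?c * (cmod z)\<^sup>2))) *\<^sub>R h z"
  have density: "normal_density 0 \<sigma> x * normal_density 0 \<sigma> y = ?c / pi * exp (- (?c * (x\<^sup>2 + y\<^sup>2)))"
    for x y
  proof -
    have "normal_density 0 \<sigma> x * normal_density 0 \<sigma> y =
        (1 / (sqrt (2 * pi * \<sigma>\<^sup>2) * sqrt (2 * pi * \<sigma>\<^sup>2))) *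
        (exp (- (x - 0)\<^sup>2 / (2 * \<sigma>\<^sup>2)) * exp (- (y - 0)\<^sup>2 / (2 * \<sigma>\<^sup>2)))"
      unfolding normal_density_def by simp
    also have "sqrt (2 * pi * \<sigma>\<^sup>2) * sqrt (2 * pi * \<sigma>\<^sup>2) = 2 * pi * \<sigma>\<^sup>2"
      by (rule real_sqrt_mult_self[THEN trans]) simp
    also have "exp (- (x - 0)\<^sup>2 / (2 * \<sigma>\<^sup>2)) * exp (- (y - 0)\<^sup>2 / (2 * \<sigma>\<^sup>2)) =
        exp (- (?c * (x\<^sup>2 + y\<^sup>2)))"
      by (simp add: distrib_left add_divide_distrib flip: exp_add)
    finally show ?thesis by simp
  qed
  have eq: "(\<lambda>p. ?G (case p of (x, y) \<Rightarrow> Complex x y)) = F"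
    by (auto simp: F_def density cmod_power2 scaleR_conv_of_real)
  have "integrable (complex_gaussian ?c) h \<longleftrightarrow> integrable lborel ?G"
    unfolding complex_gaussian_def using \<open>\<sigma> > 0\<close> by (subst integrable_density) auto
  also have "\<dots> \<longleftrightarrow> integrable (lborel \<Otimes>\<^sub>M lborel) F"
    by (subst lborel_complex, subst integrable_distr_eq) (simp_all only: eq, auto)
  finally show "integrable (complex_gaussian ?c) h \<longleftrightarrow> integrable (lborel \<Otimes>\<^sub>M lborel) F" .
  have "(\<integral>z. h z \<partial>complex_gaussian ?c) = (\<integral>z. ?G z \<partial>lborel)"
    unfolding complex_gaussian_def using \<open>\<sigma> > 0\<close> by (subst integral_density) auto
  also have "\<dots> = (\<integral>p. F p \<partial>(lborel \<Otimes>\<^sub>M lborel))"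
    by (subst lborel_complex, subst integral_distr) (simp_all only: eq, auto)
  finally show "(\<integral>z. h z \<partial>complex_gaussian ?c) = (\<integral>p. F p \<partial>(lborel \<Otimes>\<^sub>M lborel))" .
qed

text \<open>The integrand is a function of the real part times one of the imaginary part, so Fubini
  applies.\<close>

lemma complex_gaussian_Re_Im_moment:
  assumes "\<sigma> > 0"
  shows "integrable (complex_gaussian (1 / (2 * \<sigma>\<^sup>2))) (\<lambda>z. of_real (Re z) ^ i * of_real (Im z) ^ j :: complex)"
    and "(\<integral>z. of_real (Re z) ^ i * of_real (Im z) ^ j \<partial>complex_gaussian (1 / (2 * \<sigma>\<^sup>2))) =
      complex_of_real (normal_moment \<sigma> i * normal_moment \<sigma> j)"
proof -
  define G where "G = (\<lambda>(x, y). (complex_of_real (normal_density 0 \<sigma> x * x ^ i)) *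
    complex_of_real (normal_density 0 \<sigma> y * y ^ j))"
  have int: "integrable lborel (\<lambda>x. complex_of_real (normal_density 0 \<sigma> x * x ^ k))" for k
    using integrable_normal_moment[OF assms, of 0 k] by (intro integrable_of_real) simp
  have eq: "(\<lambda>(x, y). complex_of_real (normal_density 0 \<sigma> x * normal_density 0 \<sigma> y) *
      (of_real (Re (Complex x y)) ^ i * of_real (Im (Complex x y)) ^ j)) = G"
    by (auto simp: G_def mult_ac)
  have G: "integrable (lborel \<Otimes>\<^sub>M lborel) G"
  proof (rule lborel_pair.Fubini_integrable)
    show "AE x in lborel. integrable lborel (\<lambda>y. G (x, y))"
      unfolding G_def by (intro AE_I2, simp only: prod.case, intro integrable_mult_right int)
    show "integrable lborel (\<lambda>x. LINT y|lborel. norm (G (x, y)))"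
      unfolding G_def prod.case norm_mult integral_mult_right_zero
      by (intro integrable_mult_left integrable_norm int)
  qed (simp add: G_def)
  then show "integrable (complex_gaussian (1 / (2 * \<sigma>\<^sup>2))) (\<lambda>z. of_real (Re z) ^ i * of_real (Im z) ^ j :: complex)"
    by (subst complex_gaussian_integral) (simp_all only: assms eq, simp_all)
  have "(\<integral>z. of_real (Re z) ^ i * of_real (Im z) ^ j \<partial>complex_gaussian (1 / (2 * \<sigma>\<^sup>2))) =
      (\<integral>p. G p \<partial>(lborel \<Otimes>\<^sub>M lborel))"
    by (subst complex_gaussian_integral) (simp_all only: assms eq, simp_all)
  also have "\<dots> = (\<integral>x. \<integral>y. G (x, y) \<partial>lborel \<partial>lborel)"
    by (rule lborel_pair.integral_fst'[OF G, symmetric])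
  also have "\<dots> = complex_of_real (normal_moment \<sigma> i) * complex_of_real (normal_moment \<sigma> j)"
    unfolding G_def normal_moment_def by (simp flip: integral_complex_of_real)
  finally show "(\<integral>z. of_real (Re z) ^ i * of_real (Im z) ^ j \<partial>complex_gaussian (1 / (2 * \<sigma>\<^sup>2))) =
      complex_of_real (normal_moment \<sigma> i * normal_moment \<sigma> j)" by simp
qed


section \<open>Mixed moments by Gaussian integration by parts\<close>

text \<open>The powers of \<open>Re z\<close> and \<open>Im z\<close> are carried along so that
  expanding one factor \<open>z\<close> or \<open>cnj z\<close> stays within this family of
  moments.\<close>

definition mixed_moment :: "real \<Rightarrow> nat \<Rightarrow> nat \<Rightarrow> nat \<Rightarrow> nat \<Rightarrow> complex" where
  "mixed_moment \<sigma> a b i j = (\<integral>z. z ^ a * cnj z ^ b * of_real (Re z) ^ i * of_real (Im z) ^ j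
     \<partial>complex_gaussian (1 / (2 * \<sigma>\<^sup>2)))"

lemma power_Suc_Re_Im:
  "z ^ Suc a * cnj z ^ b * of_real (Re z) ^ i * of_real (Im z) ^ j =
    z ^ a * cnj z ^ b * of_real (Re z) ^ Suc i * of_real (Im z) ^ j +
    \<i> * (z ^ a * cnj z ^ b * of_real (Re z) ^ i * of_real (Im z) ^ Suc j)"
  "z ^ a * cnj z ^ Suc b * of_real (Re z) ^ i * of_real (Im z) ^ j =
    z ^ a * cnj z ^ b * of_real (Re z) ^ Suc i * of_real (Im z) ^ j -
    \<i> * (z ^ a * cnj z ^ b * of_real (Re z) ^ i * of_real (Im z) ^ Suc j)"
proof -
  have "z = of_real (Re z) + \<i> * of_real (Im z)" "cnj z = of_real (Re z) - \<i> * of_real (Im z)"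
    by (simp_all add: complex_eq_iff)
  then have "z * w = of_real (Re z) * w + \<i> * (of_real (Im z) * w)"
    "cnj z * w = of_real (Re z) * w - \<i> * (of_real (Im z) * w)" for w
    by (metis distrib_right mult.assoc, metis left_diff_distrib mult.assoc)
  from this(1)[of "z ^ a * cnj z ^ b * of_real (Re z) ^ i * of_real (Im z) ^ j"]
    this(2)[of "z ^ a * cnj z ^ b * of_real (Re z) ^ i * of_real (Im z) ^ j"]
  show "z ^ Suc a * cnj z ^ b * of_real (Re z) ^ i * of_real (Im z) ^ j =
    z ^ a * cnj z ^ b * of_real (Re z) ^ Suc i * of_real (Im z) ^ j +
    \<i> * (z ^ a * cnj z ^ b * of_real (Re z) ^ i * of_real (Im z) ^ Suc j)"
  "z ^ a * cnj z ^ Suc b * of_real (Re z) ^ i * of_real (Im z) ^ j =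
    z ^ a * cnj z ^ b * of_real (Re z) ^ Suc i * of_real (Im z) ^ j -
    \<i> * (z ^ a * cnj z ^ b * of_real (Re z) ^ i * of_real (Im z) ^ Suc j)"
    by (simp_all add: mult_ac)
qed

context
  fixes \<sigma> :: real
  assumes \<sigma>: "\<sigma> > 0"
begin

text \<open>Expanding the factors \<open>z\<close> and \<open>cnj z\<close> one at a time lowers
  \<open>a\<close> and \<open>b\<close> but raises \<open>i\<close> or \<open>j\<close>, hence the
  induction for arbitrary \<open>i\<close> and \<open>j\<close>.\<close>

lemma integrable_mixed_moment:
  "integrable (complex_gaussian (1 / (2 * \<sigma>\<^sup>2)))
    (\<lambda>z. z ^ a * cnj z ^ b * of_real (Re z) ^ i * of_real (Im z) ^ j)"
proof (induction a arbitrary: i j)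
  case 0
  show ?case
  proof (induction b arbitrary: i j)
    case 0
    show ?case using complex_gaussian_Re_Im_moment(1)[OF \<sigma>, of i j] by simp
  next
    case (Suc b)
    then show ?case
      unfolding power_Suc_Re_Im(2) by (intro Bochner_Integration.integrable_diff integrable_mult_right)
  qed
next
  case (Suc a)
  then show ?case
    unfolding power_Suc_Re_Im(1) by (intro Bochner_Integration.integrable_add integrable_mult_right)
qed

lemma mixed_moment_Suc:
  "mixed_moment \<sigma> (Suc a) b i j = mixed_moment \<sigma> a b (Suc i) j + \<i> * mixed_moment \<sigma> a b i (Suc j)"
  "mixed_moment \<sigma> a (Suc b) i j = mixed_moment \<sigma> a b (Suc i) j - \<i> * mixed_moment \<sigma> a b i (Suc j)"
  unfolding mixed_moment_def power_Suc_Re_Im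
  by (simp_all only: Bochner_Integration.integral_add Bochner_Integration.integral_diff
      integral_mult_right_zero integrable_mult_right integrable_mixed_moment)

text \<open>Gaussian integration by parts, \<open>E (x h) = \<sigma>\<^sup>2 E (\<partial>h/\<partial>x)\<close> and \<open>E (y h) = \<sigma>\<^sup>2 E (\<partial>h/\<partial>y)\<close>. Carrying
  the factors \<open>x\<^sup>i y\<^sup>j\<close> reduces it by expanding \<open>z = x + \<i>y\<close> to the recurrence for
  real normal moments.\<close>

lemma mixed_moment_stein:
  "mixed_moment \<sigma> a b (Suc i) j = of_real (\<sigma>\<^sup>2) *
    (of_nat a * mixed_moment \<sigma> (a - 1) b i j + of_nat b * mixed_moment \<sigma> a (b - 1) i j
      + of_nat i * mixed_moment \<sigma> a b (i - 1) j)"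
  "mixed_moment \<sigma> a b i (Suc j) = of_real (\<sigma>\<^sup>2) *
    (\<i> * of_nat a * mixed_moment \<sigma> (a - 1) b i j - \<i> * of_nat b * mixed_moment \<sigma> a (b - 1) i j
      + of_nat j * mixed_moment \<sigma> a b i (j - 1))"
proof (induction a arbitrary: i j)
  case 0
  have "mixed_moment \<sigma> 0 b (Suc i) j = of_real (\<sigma>\<^sup>2) *
      (of_nat b * mixed_moment \<sigma> 0 (b - 1) i j + of_nat i * mixed_moment \<sigma> 0 b (i - 1) j) \<and>
    mixed_moment \<sigma> 0 b i (Suc j) = of_real (\<sigma>\<^sup>2) *
      (- \<i> * of_nat b * mixed_moment \<sigma> 0 (b - 1) i j + of_nat j * mixed_moment \<sigma> 0 b i (j - 1))" for i j
  proof (induction b arbitrary: i j)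
    case 0
    have "mixed_moment \<sigma> 0 0 i j = complex_of_real (normal_moment \<sigma> i * normal_moment \<sigma> j)" for i j
      using complex_gaussian_Re_Im_moment(2)[OF \<sigma>, of i j] by (simp add: mixed_moment_def)
    then show ?case
      by (simp add: normal_moment_Suc[OF \<sigma>])
  next
    case (Suc b)
    \<comment> \<open>Each term with a truncated predecessor carries a factor that is 0 exactly when
      truncation occurs; in all other cases one factor \<open>cnj z\<close> is expanded.\<close>
    have "of_nat b * mixed_moment \<sigma> 0 b i j = of_nat b * mixed_moment \<sigma> 0 (b - 1) (Suc i) j
        - \<i> * (of_nat b * mixed_moment \<sigma> 0 (b - 1) i (Suc j))"
      by (cases b) (simp_all add: mixed_moment_Suc algebra_simps)
    moreover have "of_nat i * mixed_moment \<sigma> 0 (Suc b) (i - 1) j =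
        of_nat i * mixed_moment \<sigma> 0 b i j - \<i> * (of_nat i * mixed_moment \<sigma> 0 b (i - 1) (Suc j))"
      by (cases i) (simp_all add: mixed_moment_Suc algebra_simps)
    moreover have "of_nat j * mixed_moment \<sigma> 0 (Suc b) i (j - 1) =
        of_nat j * mixed_moment \<sigma> 0 b (Suc i) (j - 1) - \<i> * (of_nat j * mixed_moment \<sigma> 0 b i j)"
      by (cases j) (simp_all add: mixed_moment_Suc algebra_simps)
    moreover note Suc[of "Suc i" j, THEN conjunct1] Suc[of i "Suc j", THEN conjunct1]
      Suc[of "Suc i" j, THEN conjunct2] Suc[of i "Suc j", THEN conjunct2] i_squared
    ultimately show ?case
      \<comment> \<open>Expanding \<open>cnj z\<close> raises \<open>i\<close> or \<open>j\<close>
        by one; the unit gained there as a coefficient is the one by which \<open>b\<close> grows to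
        \<open>Suc b\<close>.\<close>
      unfolding mixed_moment_Suc diff_Suc_1 of_nat_Suc by (intro conjI; algebra)
  qed
  then show "mixed_moment \<sigma> 0 b (Suc i) j = of_real (\<sigma>\<^sup>2) *
    (of_nat 0 * mixed_moment \<sigma> (0 - 1) b i j + of_nat b * mixed_moment \<sigma> 0 (b - 1) i j
      + of_nat i * mixed_moment \<sigma> 0 b (i - 1) j)"
  "mixed_moment \<sigma> 0 b i (Suc j) = of_real (\<sigma>\<^sup>2) *
    (\<i> * of_nat 0 * mixed_moment \<sigma> (0 - 1) b i j - \<i> * of_nat b * mixed_moment \<sigma> 0 (b - 1) i j
      + of_nat j * mixed_moment \<sigma> 0 b i (j - 1))"
    for i j by simp_all
next
  case (Suc a)
  {
    fix i j
    \<comment> \<open>The same weighted reductions, now for one factor \<open>z\<close>.\<close>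
    have a: "of_nat a * mixed_moment \<sigma> a b i j = of_nat a * mixed_moment \<sigma> (a - 1) b (Suc i) j
        + \<i> * (of_nat a * mixed_moment \<sigma> (a - 1) b i (Suc j))"
      by (cases a) (simp_all add: mixed_moment_Suc algebra_simps)
    have i: "of_nat i * mixed_moment \<sigma> (Suc a) b (i - 1) j =
        of_nat i * mixed_moment \<sigma> a b i j + \<i> * (of_nat i * mixed_moment \<sigma> a b (i - 1) (Suc j))"
      by (cases i) (simp_all add: mixed_moment_Suc algebra_simps)
    have j: "of_nat j * mixed_moment \<sigma> (Suc a) b i (j - 1) =
        of_nat j * mixed_moment \<sigma> a b (Suc i) (j - 1) + \<i> * (of_nat j * mixed_moment \<sigma> a b i j)"
      by (cases j) (simp_all add: mixed_moment_Suc algebra_simps)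
    note a i j
  } note red = this
  show "mixed_moment \<sigma> (Suc a) b (Suc i) j = of_real (\<sigma>\<^sup>2) *
    (of_nat (Suc a) * mixed_moment \<sigma> (Suc a - 1) b i j + of_nat b * mixed_moment \<sigma> (Suc a) (b - 1) i j
      + of_nat i * mixed_moment \<sigma> (Suc a) b (i - 1) j)" for i j
    using red(1,2)[of i j] Suc(1)[of "Suc i" j] Suc(1)[of i "Suc j"] i_squared
    unfolding mixed_moment_Suc(1)[of a b "Suc i"] mixed_moment_Suc(1)[of a "b - 1"] diff_Suc_1 of_nat_Suc
    by algebra
  show "mixed_moment \<sigma> (Suc a) b i (Suc j) = of_real (\<sigma>\<^sup>2) *
    (\<i> * of_nat (Suc a) * mixed_moment \<sigma> (Suc a - 1) b i j - \<i> * of_nat b * mixed_moment \<sigma> (Suc a) (b - 1) i j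
      + of_nat j * mixed_moment \<sigma> (Suc a) b i (j - 1))" for i j
    using red(1)[of i j] red(3)[of j i] Suc(2)[of "Suc i" j] Suc(2)[of i "Suc j"] i_squared
    unfolding mixed_moment_Suc(1)[of a b i "Suc j"] mixed_moment_Suc(1)[of a "b - 1"] diff_Suc_1 of_nat_Suc
    by algebra
qed

text \<open>Multiplication by \<open>z = x + \<i>y\<close> becomes \<sigma>-squared times
  \<open>d/dx + \<i> d/dy\<close>, twice the derivative in \<open>cnj z\<close>: the terms from
  powers of \<open>z\<close> cancel and those from \<open>cnj z\<close> double. The second identity
  is the conjugate case.\<close>

lemma mixed_moment_z:
  "mixed_moment \<sigma> (Suc a) b 0 0 = 2 * of_real (\<sigma>\<^sup>2) * of_nat b * mixed_moment \<sigma> a (b - 1) 0 0"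
  "mixed_moment \<sigma> a (Suc b) 0 0 = 2 * of_real (\<sigma>\<^sup>2) * of_nat a * mixed_moment \<sigma> (a - 1) b 0 0"
  unfolding mixed_moment_Suc
  by (simp_all add: mixed_moment_stein[of a b 0 0] algebra_simps)

text \<open>Each factor \<open>z\<close> is paired with one factor \<open>cnj z\<close>; an unpaired
  factor of either kind makes the moment vanish.\<close>

lemma mixed_moment_eq:
  "mixed_moment \<sigma> a b 0 0 = (if a = b then fact a * (2 * of_real (\<sigma>\<^sup>2)) ^ a else 0)"
proof (induction a arbitrary: b)
  case 0
  have "mixed_moment \<sigma> 0 0 0 0 = 1"
    using complex_gaussian_Re_Im_moment(2)[OF \<sigma>, of 0 0]
    by (simp add: mixed_moment_def normal_moment_0[OF \<sigma>])
  then show ?case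
    by (cases b) (simp_all add: mixed_moment_z(2))
next
  case (Suc a)
  then show ?case
    by (cases b) (simp_all add: mixed_moment_z(1) mult_ac)
qed

end

lemma complex_gaussian_moment:
  assumes "c > 0"
  shows "integrable (complex_gaussian c) (\<lambda>z. z ^ a * cnj z ^ b)"
    and "(\<integral>z. z ^ a * cnj z ^ b \<partial>complex_gaussian c) = (if a = b then fact a / of_real c ^ a else 0)"
proof -
  \<comment> \<open>The standard deviation of each coordinate, chosen so that
    \<open>1 / (2 * \<sigma>\<^sup>2)\<close> is \<open>c\<close>.\<close>
  define \<sigma> where "\<sigma> = sqrt (1 / (2 * c))"
  have \<sigma>: "\<sigma> > 0" and \<sigma>2: "\<sigma>\<^sup>2 = 1 / (2 * c)"
    unfolding \<sigma>_def using assms by simp_all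
  have c: "1 / (2 * \<sigma>\<^sup>2) = c" "2 * of_real (\<sigma>\<^sup>2) = 1 / complex_of_real c"
    using assms unfolding \<sigma>2 by simp_all
  show "integrable (complex_gaussian c) (\<lambda>z. z ^ a * cnj z ^ b)"
    using integrable_mixed_moment[OF \<sigma>, of a b 0 0] by (simp only: c) simp
  show "(\<integral>z. z ^ a * cnj z ^ b \<partial>complex_gaussian c) = (if a = b then fact a / of_real c ^ a else 0)"
    using mixed_moment_eq[OF \<sigma>, of a b] unfolding mixed_moment_def c
    by (auto simp: power_one_over)
qed

lemma prob_space_complex_gaussian:
  assumes "c > 0"
  shows "prob_space (complex_gaussian c)"
proof -
  \<comment> \<open>The total mass is the moment with both exponents 0.\<close>
  have "integrable (complex_gaussian c) (\<lambda>_. 1 :: complex)" "(\<integral>_. 1 \<partial>complex_gaussian c) = (1 :: complex)"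
    using complex_gaussian_moment[OF assms, of 0 0] by simp_all
  then have "measure (complex_gaussian c) UNIV = 1"
    by (simp add: scaleR_conv_of_real)
  \<comment> \<open>\<open>measure\<close> assigns 0 to infinite mass, so the value 1 shows
    finiteness.\<close>
  moreover from this have "emeasure (complex_gaussian c) UNIV \<noteq> \<infinity>"
    by (auto simp: measure_def)
  ultimately show ?thesis
    by (intro prob_spaceI) (simp add: emeasure_eq_ennreal_measure)
qed

section \<open>Expectations of monomials\<close>

text \<open>The factor at the index \<open>0 \<notin> {1..}\<close> is irrelevant, but must be a probability measure for the
  locale \<open>product_prob_space\<close>.\<close>

lemma nu_eq: "nu \<beta> = (\<Pi>\<^sub>M n\<in>{1..}. complex_gaussian (if n = 0 then 1 else real n * \<beta>))"
  unfolding nu_def complex_gaussian_def by (intro PiM_cong) auto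

text \<open>A monomial depends only on the finitely many coordinates in the supports. Their joint
  law is a finite product measure, over which the integral factors into one-dimensional
  moments.\<close>

lemma nu_moment:
  assumes "\<beta> > 0" "is_multi_index a" "is_multi_index b"
  shows "integrable (nu \<beta>) (\<lambda>f. mi_power f a * cnj (mi_power f b))"
    and "(\<integral>f. mi_power f a * cnj (mi_power f b) \<partial>nu \<beta>) =
      (if a = b then of_real (real (mi_fact a) / mi_power real a * \<beta> powi (- int (mi_size a))) else 0)"
proof -
  define c where "c n = (if n = 0 then 1 else real n * \<beta>)" for n :: nat
  define M where "M n = complex_gaussian (c n)" for n
  define S where "S = keys a \<union> keys b"
  define g where "g k z = z ^ lookup a k * cnj z ^ lookup b k" for k and z :: complex
  define h where "h f = (\<Prod>k\<in>S. g k (f k))" for f :: "nat \<Rightarrow> complex"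
  have c: "c n > 0" for n
    using assms(1) by (simp add: c_def)
  have nu: "nu \<beta> = PiM {1..} M"
    unfolding nu_eq M_def[abs_def] c_def ..
  interpret prob_space "M n" for n
    unfolding M_def using c by (rule prob_space_complex_gaussian)
  interpret product_prob_space M "{1..}" ..
  have S: "finite S" "S \<subseteq> {1..}"
    using assms(2,3) by (auto simp: S_def is_multi_index_def in_keys_iff Suc_le_eq intro!: gr0I)
  have h: "mi_power f a * cnj (mi_power f b) = h f" for f
    using S(1) by (simp add: h_def g_def S_def mi_power_superset[of S] prod.distrib)
  have restrict: "h (restrict f S) = h f" for f
    unfolding h_def by (intro prod.cong) auto
  have marginal: "distr (nu \<beta>) (PiM S M) (\<lambda>x. restrict x S) = PiM S M"
    unfolding nu using S by (rule distr_PiM_restrict_finite)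
  have res_meas: "(\<lambda>x. restrict x S) \<in> measurable (nu \<beta>) (PiM S M)"
    unfolding nu using S(2) by (rule measurable_restrict_subset)
  have g: "integrable (M k) (g k)" for k
    unfolding M_def g_def using c by (rule complex_gaussian_moment)
  have g_integral: "(\<integral>z. g k z \<partial>M k) =
      (if lookup a k = lookup b k then fact (lookup a k) / of_real (c k) ^ lookup a k else 0)" for k
    unfolding M_def g_def using c by (rule complex_gaussian_moment)
  have int: "integrable (PiM S M) h"
    unfolding h_def using S(1) g by (rule product_integrable_prod)
  have "integrable (nu \<beta>) (\<lambda>f. h (restrict f S))"
    by (rule integrable_distr[OF res_meas]) (simp add: marginal int)
  then show "integrable (nu \<beta>) (\<lambda>f. mi_power f a * cnj (mi_power f b))"
    by (simp add: h restrict)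
  have "(\<integral>f. mi_power f a * cnj (mi_power f b) \<partial>nu \<beta>) = (\<integral>f. h (restrict f S) \<partial>nu \<beta>)"
    by (simp add: h restrict)
  also have "\<dots> = (\<integral>f. h f \<partial>PiM S M)"
    using integral_distr[OF res_meas borel_measurable_integrable[OF int]] by (simp add: marginal)
  also have "\<dots> = (\<Prod>k\<in>S. if lookup a k = lookup b k then fact (lookup a k) / of_real (c k) ^ lookup a k else 0)"
    unfolding h_def using product_integral_prod[OF S(1) g] by (simp only: g_integral)
  also have "\<dots> = (if a = b then of_real (real (mi_fact a) / mi_power real a * \<beta> powi (- int (mi_size a))) else 0)"
  proof (cases "a = b")
    case True
    \<comment> \<open>The rate \<open>c k\<close> is \<open>real k * \<beta>\<close>: the powers of
      \<open>k\<close> assemble to \<open>mi_power real a\<close>, those of \<beta> to the exponent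
      \<open>mi_size a\<close>.\<close>
    have "fact (lookup a k) / of_real (c k) ^ lookup a k =
        complex_of_real (fact (lookup a k) / real k ^ lookup a k * (1 / \<beta> ^ lookup a k))" if "k \<in> S" for k
      using that S(2) by (auto simp: c_def power_mult_distrib)
    moreover have "\<beta> powi (- int (mi_size a)) = (\<Prod>k\<in>S. 1 / \<beta> ^ lookup a k)"
      unfolding power_int_minus power_int_of_nat using S(1)
      by (simp add: S_def mi_size_superset[of S] power_sum prod_dividef inverse_eq_divide)
    moreover have "keys a \<subseteq> S" by (simp add: S_def)
    ultimately show ?thesis
      using True S(1)
      by (simp add: mi_fact_superset[of S] mi_power_superset[of S] flip: prod.distrib prod_dividef)
  next
    case False
    \<comment> \<open>A coordinate with different exponents contributes a factor 0.\<close>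
    then obtain k where "lookup a k \<noteq> lookup b k"
      by (auto intro: poly_mapping_eqI)
    moreover from this have "k \<in> S"
      by (auto simp: S_def in_keys_iff)
    ultimately show ?thesis
      using False S(1) by (auto intro!: prod_zero)
  qed
  finally show "(\<integral>f. mi_power f a * cnj (mi_power f b) \<partial>nu \<beta>) =
      (if a = b then of_real (real (mi_fact a) / mi_power real a * \<beta> powi (- int (mi_size a))) else 0)" .
qed

section \<open>Assembly of the expectation formula\<close>

theorem theorem5p1:
  fixes \<beta> :: real and p q :: multi_index
  assumes "\<beta> > 0" and "is_multi_index p" and "is_multi_index q"
  shows "integrable (nu \<beta>) (\<lambda>f. mi_power (x_coeff f) p * cnj (mi_power (x_coeff f) q))
    \<and> (mi_deg p = mi_deg q \<longrightarrow>
        (\<integral>f. mi_power (x_coeff f) p * cnj (mi_power (x_coeff f) q) \<partial>nu \<beta>) =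
        complex_of_real (\<Sum>(J, K)\<in>family_pairs p q.
            1 / (real (\<Prod>i\<in>family_index p. mi_fact (J i))
                 * real (\<Prod>i\<in>family_index q. mi_fact (K i)))
          * (real (mi_fact (family_sum p J)) / mi_power real (family_sum p J))
          * \<beta> powi (- int (mi_size (family_sum p J)))))
    \<and> (mi_deg p \<noteq> mi_deg q \<longrightarrow>
        (\<integral>f. mi_power (x_coeff f) p * cnj (mi_power (x_coeff f) q) \<partial>nu \<beta>) = 0)"
proof -
  define F where "F f = mi_power (x_coeff f) p * cnj (mi_power (x_coeff f) q)" for f
  define G where "G a b f = mi_power f a * cnj (mi_power f b)" for a b and f :: "nat \<Rightarrow> complex"
  define t where "t = (\<lambda>(J, K). 1 / (real (\<Prod>i\<in>family_index p. mi_fact (J i))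
                 * real (\<Prod>i\<in>family_index q. mi_fact (K i)))
          * (real (mi_fact (family_sum p J)) / mi_power real (family_sum p J))
          * \<beta> powi (- int (mi_size (family_sum p J))))"
  \<comment> \<open>The coefficients are real, so conjugation acts on the monomials alone.\<close>
  have cnj_coeff: "cnj (family_coeff q K) = family_coeff q K" for K
    by (simp add: family_coeff_def)
  have F: "F f = (\<Sum>(J, K)\<in>families p \<times> families q.
      family_coeff p J * family_coeff q K * G (family_sum p J) (family_sum q K) f)" for f
    by (simp add: F_def G_def mi_power_x_coeff assms cnj_coeff sum_product mult_ac
        flip: sum.cartesian_product)
  have moment: "integrable (nu \<beta>) (G (family_sum p J) (family_sum q K))"
    "family_coeff p J * family_coeff q K * (\<integral>f. G (family_sum p J) (family_sum q K) f \<partial>nu \<beta>) =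
      (if family_sum p J = family_sum q K then of_real (t (J, K)) else 0)"
    if "J \<in> families p" "K \<in> families q" for J K
  proof -
    note m = nu_moment[OF assms(1) is_multi_index_family_sum[OF that(1)] is_multi_index_family_sum[OF that(2)],
        folded G_def]
    show "integrable (nu \<beta>) (G (family_sum p J) (family_sum q K))"
      by (rule m(1))
    \<comment> \<open>Equal family sums have equal sizes, so the two signs multiply to 1.\<close>
    have "family_coeff p J * family_coeff q K =
        1 / (of_nat (\<Prod>i\<in>family_index p. mi_fact (J i)) * of_nat (\<Prod>i\<in>family_index q. mi_fact (K i)))"
      if "family_sum p J = family_sum q K"
      by (simp add: family_coeff_def that flip: power_add)
    then show "family_coeff p J * family_coeff q K * (\<integral>f. G (family_sum p J) (family_sum q K) f \<partial>nu \<beta>) =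
      (if family_sum p J = family_sum q K then of_real (t (J, K)) else 0)"
      by (auto simp: m(2) t_def)
  qed
  have int: "integrable (nu \<beta>) F"
    unfolding F case_prod_unfold
    by (intro Bochner_Integration.integrable_sum integrable_mult_right moment(1)) auto
  have "(\<integral>f. F f \<partial>nu \<beta>) = (\<Sum>z\<in>families p \<times> families q.
      if family_sum p (fst z) = family_sum q (snd z) then of_real (t z) else 0)"
    unfolding F case_prod_unfold
    by (subst Bochner_Integration.integral_sum)
      (auto simp: moment intro!: sum.cong)
  also have "\<dots> = (\<Sum>z\<in>family_pairs p q. of_real (t z))"
    using assms
    by (intro sum.mono_neutral_cong_right) (auto simp: family_pairs_def finite_families)
  finally have eq: "(\<integral>f. F f \<partial>nu \<beta>) = of_real (\<Sum>z\<in>family_pairs p q. t z)"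
    by simp
  \<comment> \<open>A common family sum would have both degrees at once.\<close>
  have "family_pairs p q = {}" if "mi_deg p \<noteq> mi_deg q"
    using that by (auto simp: family_pairs_def) (metis mi_deg_family_sum assms(2,3))
  with int eq show ?thesis
    by (simp add: F_def[abs_def] t_def)
qed

end
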